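(* Let $K\in\mathbb{C}^{n\times n}$ be a (possibly non-Hermitian) marginal kernel matrix of a DPP on $[n]$. Run, in exact arithmetic, the randomized modified LU factorization $\mathcal{A}$ described in the context on input $K$, and let $Y\subseteq[n]$ and $A$ denote the returned sample and the returned matrix. Then: 1. Almost surely, the algorithm provides a sample from $\mathrm{DPP}(K)$ (that is, almost surely it completes with every division well-defined, and the returned random set is distributed as $\mathrm{DPP}(K)$). 2. The algorithm involves roughly $\tfrac23 n^3$ floating-point operations (that is, the highest-order term of its operation count is $\tfrac23 n^3$). 3. The likelihood of any returned sample $Y$ is the product of the absolute values of the diagonal entries of the returned matrix, $\prod_{j=0}^{n-1}|A_{j,j}|$. 4. If $K$ is Hermitian, the work can be roughly halved (in the highest-order term of the operation count) by exploiting symmetry in the Schur complement updates.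
   Context: Notation: $[n]=\{0,1,\dots,n-1\}$, and $[j:k]=\{j,j+1,\dots,k-1\}$. For an $n\times n$ matrix $K$ and $Y,Z\subseteq[n]$, $K_{Y,Z}$ is the submatrix with row indices in $Y$ and column indices in $Z$, and $K_Y=K_{Y,Y}$. The determinant of the empty matrix is $1$. A finite determinantal point process (DPP) with marginal kernel matrix $K\in\mathbb{C}^{n\times n}$ is a random subset $\mathbf{Y}$ of $[n]$ such that $\mathbb{P}[Y\subseteq\mathbf{Y}]=\det(K_Y)$ for every $Y\subseteq[n]$; its distribution is denoted $\mathrm{DPP}(K)$. A matrix $K$ is a marginal kernel matrix (admissible) if such a random subset exists. The likelihood of a sample $Y$ is $\mathbb{P}[\mathbf{Y}=Y]$. Algorithm $\mathcal{A}$ (unblocked, right-looking DPP sampling). Initialize $Y:=\emptyset$ and $A:=K$. For $j=0,1,\dots,n-1$ in order: (i) Draw a Bernoulli variable with success probability equal to the current diagonal entry $A_{j,j}$ (with fresh randomness given the past). If it succeeds, add $j$ to $Y$; otherwise replace $A_{j,j}$ by $A_{j,j}-1$. (ii) Replace $A_{[j+1:n],\{j\}}$ by $A_{[j+1:n],\{j\}}/A_{j,j}$. (iii) Schur complement update: replace $A_{[j+1:n]}$ by $A_{[j+1:n]}-A_{[j+1:n],\{j\}}\,A_{\{j\},[j+1:n]}$. Return $Y$ and $A$. In the Hermitian case, exploiting symmetry means that the outer-product updates in step (iii) are only computed for one triangle of the matrix, as in an $LDL^H$ factorization. *)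

theory Defs
  imports
    "HOL-Probability.SPMF"
    "Jordan_Normal_Form.Determinant"
    "Jordan_Normal_Form.DL_Submatrix"
    "Jordan_Normal_Form.Schur_Decomposition"
begin

hide_const (open) Determinants.det

text \<open>
  \<open>is_DPP K P\<close>: \<open>P\<close> is the law of a random subset of \<open>{..<n}\<close>, \<open>n\<close> the size of \<open>K\<close>, whose marginal
  kernel matrix is \<open>K\<close>. The kernel \<open>K\<close> is admissible iff such a \<open>P\<close> exists.
\<close>

definition is_DPP :: "complex mat \<Rightarrow> nat set pmf \<Rightarrow> bool" where
  "is_DPP K P \<longleftrightarrow>
     set_pmf P \<subseteq> Pow {..<dim_row K} \<and>
     (\<forall>Y\<subseteq>{..<dim_row K}.
        complex_of_real (measure_pmf.prob P {S. Y \<subseteq> S}) = det (submatrix K Y Y))"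

definition hermitian_mat :: "complex mat \<Rightarrow> bool" where
  "hermitian_mat K \<longleftrightarrow> mat_adjoint K = K"

text \<open>
  Randomized programs that return a value together with the number of scalar operations executed.
  The deficient mass of the \<open>spmf\<close> is the probability that the program gets stuck: at a division
  by zero, or at a Bernoulli draw whose parameter is not a real number in \<open>[0, 1]\<close>. Without these
  guards \<open>x / 0 = 0\<close> and the truncation in \<open>bernoulli_pmf\<close> would hide such events.
\<close>

type_synonym 'a counted = "('a \<times> nat) spmf"

definition ret :: "'a \<Rightarrow> 'a counted" where
  "ret x = return_spmf (x, 0)"

definition stuck :: "'a counted" where
  "stuck = return_pmf None"

definition and_then :: "'a counted \<Rightarrow> ('a \<Rightarrow> 'b counted) \<Rightarrow> 'b counted" (infixl \<open>\<triangleright>\<close> 54) where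
  "m \<triangleright> f = bind_spmf m (\<lambda>(x, s). map_spmf (\<lambda>(y, t). (y, s + t)) (f x))"

primrec for_each :: "nat list \<Rightarrow> (nat \<Rightarrow> 's \<Rightarrow> 's counted) \<Rightarrow> 's \<Rightarrow> 's counted" where
  "for_each [] f s = ret s"
| "for_each (i # js) f s = f i s \<triangleright> for_each js f"

definition flop :: "complex \<Rightarrow> complex counted" where
  "flop x = return_spmf (x, 1)"

definition fl_sub :: "complex \<Rightarrow> complex \<Rightarrow> complex counted" where
  "fl_sub x y = flop (x - y)"

definition fl_mult :: "complex \<Rightarrow> complex \<Rightarrow> complex counted" where
  "fl_mult x y = flop (x * y)"

definition fl_div :: "complex \<Rightarrow> complex \<Rightarrow> complex counted" where
  "fl_div x y = (if y = 0 then stuck else flop (x / y))"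

definition fl_cnj :: "complex \<Rightarrow> complex counted" where
  "fl_cnj x = flop (cnj x)"

definition draw :: "complex \<Rightarrow> bool counted" where
  "draw z = (if z \<in> \<real> \<and> 0 \<le> Re z \<and> Re z \<le> 1
             then map_spmf (\<lambda>b. (b, 0)) (spmf_of_pmf (bernoulli_pmf (Re z)))
             else stuck)"

definition scale_entry :: "nat \<Rightarrow> nat \<Rightarrow> complex mat \<Rightarrow> complex mat counted" where
  "scale_entry j i A =
     fl_div (A $$ (i, j)) (A $$ (j, j)) \<triangleright> (\<lambda>q. ret (A |\<^sub>m (i, j) \<mapsto> q))"

definition schur_entry :: "nat \<Rightarrow> nat \<Rightarrow> nat \<Rightarrow> complex mat \<Rightarrow> complex mat counted" where
  "schur_entry j i k A =
     fl_mult (A $$ (i, j)) (A $$ (j, k)) \<triangleright> (\<lambda>p.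
     fl_sub (A $$ (i, k)) p \<triangleright> (\<lambda>d.
     ret (A |\<^sub>m (i, k) \<mapsto> d)))"

definition reflect_entry :: "nat \<Rightarrow> nat \<Rightarrow> complex mat \<Rightarrow> complex mat counted" where
  "reflect_entry j k A = fl_cnj (A $$ (k, j)) \<triangleright> (\<lambda>c. ret (A |\<^sub>m (j, k) \<mapsto> c))"

definition lu_eliminate :: "nat \<Rightarrow> nat \<Rightarrow> complex mat \<Rightarrow> complex mat counted" where
  "lu_eliminate n j A =
     for_each [j+1..<n] (scale_entry j) A \<triangleright>
     for_each [j+1..<n] (\<lambda>i. for_each [j+1..<n] (schur_entry j i))"

text \<open>
  The Hermitian variant updates only the lower triangle (\<open>k \<le> i\<close>) of the Schur complement. Row \<open>j\<close>
  right of the diagonal, which has therefore not been kept up to date, is the conjugate of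
  column \<open>j\<close> and is filled in just before that column is scaled. The conjugations are counted as
  operations.
\<close>

definition ldl_eliminate :: "nat \<Rightarrow> nat \<Rightarrow> complex mat \<Rightarrow> complex mat counted" where
  "ldl_eliminate n j A =
     for_each [j+1..<n] (reflect_entry j) A \<triangleright>
     for_each [j+1..<n] (scale_entry j) \<triangleright>
     for_each [j+1..<n] (\<lambda>i. for_each [j+1..<i+1] (schur_entry j i))"

definition dpp_step ::
  "(nat \<Rightarrow> complex mat \<Rightarrow> complex mat counted) \<Rightarrow> nat \<Rightarrow> nat set \<times> complex mat
    \<Rightarrow> (nat set \<times> complex mat) counted" where
  "dpp_step eliminate j = (\<lambda>(Y, A).
     draw (A $$ (j, j)) \<triangleright> (\<lambda>b.
       if b then eliminate j A \<triangleright> (\<lambda>A'. ret (insert j Y, A'))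
       else fl_sub (A $$ (j, j)) 1 \<triangleright> (\<lambda>d.
            eliminate j (A |\<^sub>m (j, j) \<mapsto> d) \<triangleright> (\<lambda>A'. ret (Y, A')))))"

definition dpp_sampler :: "nat \<Rightarrow> complex mat \<Rightarrow> (nat set \<times> complex mat) counted" where
  "dpp_sampler n K = for_each [0..<n] (dpp_step (lu_eliminate n)) ({}, K)"

definition dpp_sampler_hermitian :: "nat \<Rightarrow> complex mat \<Rightarrow> (nat set \<times> complex mat) counted" where
  "dpp_sampler_hermitian n K = for_each [0..<n] (dpp_step (ldl_eliminate n)) ({}, K)"

end

theory Submission
  imports Defs
begin

text \<open>
  For a fixed outcome \<open>S\<close> of the draws, the sampler is a deterministic elimination; its successive
  matrices form the trajectory of \<open>S\<close>. Let \<open>P\<close> be the law of the determinantal process, and let \<open>S\<close> be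
  in its support. The key invariant (\<open>trajectory_minors\<close>) says that after \<open>j\<close> steps, for every
  \<open>Z \<subseteq> {j..<n}\<close>, the probability that a random set with law \<open>P\<close> agrees with \<open>S\<close> below \<open>j\<close> and contains
  \<open>Z\<close> equals the product of \<open>\<bar>A\<^sub>i\<^sub>i\<bar>\<close> over \<open>i < j\<close>, times the minor of \<open>A\<close> with row and column set \<open>Z\<close>.
  For \<open>j = 0\<close> this is the definition of the process. If \<open>j \<in> S\<close>, the step is the Schur complement
  formula for the minor at \<open>insert j Z\<close> (\<open>det_submatrix_lu_step\<close>). If \<open>j \<notin> S\<close>, the probability is
  the difference of those for \<open>Z\<close> and \<open>insert j Z\<close>; since the determinant is affine in the diagonal
  entry, the corresponding difference of minors is, up to sign, the minor at \<open>insert j Z\<close> after that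
  entry has been decremented (\<open>det_submatrix_change_pivot\<close>), and the Schur complement applies again.

  For \<open>Z = {}\<close> and \<open>Z = {j}\<close> the invariant shows that the diagonal entry met in step \<open>j\<close> is the
  conditional probability of drawing \<open>j\<close> given the past. Hence it lies in \<open>[0, 1]\<close>, the pivot is
  almost surely nonzero, and the sampler has the same law as drawing \<open>S\<close> from \<open>P\<close> and returning \<open>S\<close> with
  the end of its trajectory (\<open>sampler_law\<close>). For \<open>j = n\<close> the invariant is the likelihood formula.

  In the Hermitian case the trailing blocks stay Hermitian, so the variant that updates one triangle
  follows the same trajectories up to entries that are rewritten before they are read
  (\<open>ldl_trajectory_agrees\<close>). The operation counts follow by summing over the steps.
\<close>

section \<open>Pivoting and principal minors\<close>

lemma det_pivot_factor:
  fixes M :: "'a :: field mat"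
  assumes M: "M \<in> carrier_mat (Suc m) (Suc m)" and d: "M $$ (0,0) \<noteq> 0"
  shows "det M = M $$ (0,0) *
    det (mat m m (\<lambda>(i,k). M $$ (Suc i, Suc k) - M $$ (Suc i, 0) / M $$ (0,0) * M $$ (0, Suc k)))"
proof -
  let ?d = "M $$ (0,0)"
  let ?S = "mat m m (\<lambda>(i,k). M $$ (Suc i, Suc k) - M $$ (Suc i, 0) / ?d * M $$ (0, Suc k))"
  let ?l = "mat m 1 (\<lambda>(i,_). M $$ (Suc i, 0) / ?d)"
  let ?r = "mat 1 m (\<lambda>(_,k). M $$ (0, Suc k))"
  let ?c = "mat 1 1 (\<lambda>_. ?d)"
  \<comment> \<open>One step of block LU factorization: \<open>M = L U\<close>, with \<open>L\<close> unipotent.\<close>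
  let ?L = "four_block_mat (1\<^sub>m 1) (0\<^sub>m 1 m) ?l (1\<^sub>m m)"
  let ?U = "four_block_mat ?c ?r (0\<^sub>m m 1) ?S"
  have "?L * ?U = four_block_mat (1\<^sub>m 1 * ?c + 0\<^sub>m 1 m * 0\<^sub>m m 1) (1\<^sub>m 1 * ?r + 0\<^sub>m 1 m * ?S)
      (?l * ?c + 1\<^sub>m m * 0\<^sub>m m 1) (?l * ?r + 1\<^sub>m m * ?S)"
    by (rule mult_four_block_mat) auto
  also have lc: "?l * ?c + 1\<^sub>m m * 0\<^sub>m m 1 = ?l * ?c"
    by (subst left_mult_one_mat[of _ m 1], simp) (intro right_add_zero_mat mult_carrier_mat[of _ m 1 _ 1]; simp)
  also have "four_block_mat (1\<^sub>m 1 * ?c + 0\<^sub>m 1 m * 0\<^sub>m m 1) (1\<^sub>m 1 * ?r + 0\<^sub>m 1 m * ?S)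
      (?l * ?c) (?l * ?r + 1\<^sub>m m * ?S) = four_block_mat ?c ?r (?l * ?c) (?l * ?r + ?S)"
    by (simp add: left_mult_one_mat[of _ m m] left_mult_one_mat[of _ "Suc 0" m]
      left_mult_one_mat[of _ "Suc 0" "Suc 0"] left_mult_zero_mat[of _ m m] left_mult_zero_mat[of _ m "Suc 0"]
      right_add_zero_mat[of _ "Suc 0" m] right_add_zero_mat[of _ "Suc 0" "Suc 0"])
  also have "\<dots> = M"
    using M d by (intro eq_matI) (auto simp: scalar_prod_def less_Suc_eq_0_disj)
  finally have LU: "?L * ?U = M" .
  have "det (?L * ?U) = det ?L * det ?U"
    by (rule det_mult[of _ "1 + m"]; intro four_block_carrier_mat; simp)
  moreover have "det ?L = 1"
    by (subst det_four_block_mat_upper_right_zero[of _ 1 _ m]) auto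
  moreover have "det ?U = ?d * det ?S"
    by (subst det_four_block_mat_lower_left_zero[of _ 1 _ m]) (auto simp: det_single)
  ultimately show ?thesis unfolding LU by simp
qed

text \<open>
  The determinant is affine in the corner entry, and its slope is the complementary minor.
\<close>

lemma det_change_corner:
  fixes M :: "'a :: comm_ring_1 mat"
  assumes M: "M \<in> carrier_mat (Suc m) (Suc m)"
  shows "det M = det (M |\<^sub>m (0,0) \<mapsto> d)
    + (M $$ (0,0) - d) * det (mat m m (\<lambda>(i,k). M $$ (Suc i, Suc k)))"
proof -
  let ?N = "M |\<^sub>m (0,0) \<mapsto> d"
  have N: "?N \<in> carrier_mat (Suc m) (Suc m)" using M by auto
  have cof: "cofactor ?N 0 k = cofactor M 0 k" for k
    unfolding cofactor_def mat_delete_def using M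
    by (intro arg_cong2[where f = "(*)"] arg_cong[where f = det] eq_matI) auto
  have corner: "cofactor M 0 0 = det (mat m m (\<lambda>(i,k). M $$ (Suc i, Suc k)))"
    unfolding cofactor_def mat_delete_def using M
    by (auto intro!: arg_cong[where f = det] eq_matI)
  have "det M = M $$ (0,0) * cofactor M 0 0 + (\<Sum>k<m. M $$ (0, Suc k) * cofactor M 0 (Suc k))"
    using laplace_expansion_row[OF M, of 0] by (simp add: sum.lessThan_Suc_shift del: sum.lessThan_Suc)
  moreover have "det ?N = d * cofactor M 0 0 + (\<Sum>k<m. M $$ (0, Suc k) * cofactor M 0 (Suc k))"
    using laplace_expansion_row[OF N, of 0] M by (simp add: sum.lessThan_Suc_shift cof del: sum.lessThan_Suc)
  ultimately show ?thesis by (simp add: corner algebra_simps)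
qed

lemma pick_insert_least:
  assumes "finite Z" "\<And>z. z \<in> Z \<Longrightarrow> j < z"
  shows "pick (insert j Z) 0 = j"
    and "i < card Z \<Longrightarrow> pick (insert j Z) (Suc i) = pick Z i"
proof -
  have zero: "pick (insert j Z) 0 = j"
    unfolding pick.simps by (rule Least_equality) (auto dest: assms(2)[THEN less_imp_le])
  then show "pick (insert j Z) 0 = j" .
  show "i < card Z \<Longrightarrow> pick (insert j Z) (Suc i) = pick Z i"
  proof (induction i)
    case 0
    have "(\<lambda>a. (a = j \<or> a \<in> Z) \<and> j < a) = (\<lambda>a. a \<in> Z)" using assms(2) by auto
    with zero show ?case by simp
  next
    case (Suc i)
    have "pick Z i \<in> Z" using Suc.prems by (intro pick_in_set_le) auto
    then have "(\<lambda>a. (a = j \<or> a \<in> Z) \<and> pick Z i < a) = (\<lambda>a. a \<in> Z \<and> pick Z i < a)"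
      using assms(2) by fastforce
    with Suc show ?case by simp
  qed
qed

lemma submatrix_principal:
  assumes "A \<in> carrier_mat n n" "Z \<subseteq> {..<n}"
  shows "submatrix A Z Z = mat (card Z) (card Z) (\<lambda>(i,k). A $$ (pick Z i, pick Z k))"
proof -
  have "{i. i < n \<and> i \<in> Z} = Z" using assms(2) by auto
  with assms(1) show ?thesis unfolding submatrix_def by simp
qed

lemma submatrix_insert_least:
  assumes A: "A \<in> carrier_mat n n" and j: "j < n" and Z: "Z \<subseteq> {Suc j..<n}"
  defines "M \<equiv> submatrix A (insert j Z) (insert j Z)"
  shows "M \<in> carrier_mat (Suc (card Z)) (Suc (card Z))"
    and "M $$ (0,0) = A $$ (j,j)"
    and "i < card Z \<Longrightarrow> M $$ (Suc i, 0) = A $$ (pick Z i, j)"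
    and "k < card Z \<Longrightarrow> M $$ (0, Suc k) = A $$ (j, pick Z k)"
    and "i < card Z \<Longrightarrow> k < card Z \<Longrightarrow> M $$ (Suc i, Suc k) = A $$ (pick Z i, pick Z k)"
proof -
  have fin: "finite Z" using Z finite_subset by auto
  have least: "z \<in> Z \<Longrightarrow> j < z" for z using Z by auto
  have "j \<notin> Z" using least by blast
  then have card: "card (insert j Z) = Suc (card Z)" using fin by simp
  have "insert j Z \<subseteq> {..<n}" using j Z by auto
  note eq = M_def[unfolded submatrix_principal[OF A this] card]
  note p = pick_insert_least[OF fin least]
  show "M \<in> carrier_mat (Suc (card Z)) (Suc (card Z))" unfolding eq by simp
  show "M $$ (0,0) = A $$ (j,j)" unfolding eq by (simp add: p del: pick.simps)
  show "i < card Z \<Longrightarrow> M $$ (Suc i, 0) = A $$ (pick Z i, j)"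
    unfolding eq by (simp add: p del: pick.simps)
  show "k < card Z \<Longrightarrow> M $$ (0, Suc k) = A $$ (j, pick Z k)"
    unfolding eq by (simp add: p del: pick.simps)
  show "i < card Z \<Longrightarrow> k < card Z \<Longrightarrow> M $$ (Suc i, Suc k) = A $$ (pick Z i, pick Z k)"
    unfolding eq by (simp add: p del: pick.simps)
qed

text \<open>
  Elimination with pivot \<open>A $$ (j,j)\<close>, in closed form and in place: column \<open>j\<close> below the diagonal is
  replaced by the multipliers, the trailing block by its Schur complement, and everything else,
  the pivot included, is kept.
\<close>

definition lu_step :: "nat \<Rightarrow> nat \<Rightarrow> complex mat \<Rightarrow> complex mat" where
  "lu_step n j A = mat n n (\<lambda>(i,k).
     if j < i \<and> k = j then A $$ (i,j) / A $$ (j,j)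
     else if j < i \<and> j < k then A $$ (i,k) - A $$ (i,j) / A $$ (j,j) * A $$ (j,k)
     else A $$ (i,k))"

lemma det_submatrix_lu_step:
  assumes A: "A \<in> carrier_mat n n" and j: "j < n" and Z: "Z \<subseteq> {Suc j..<n}"
    and d: "A $$ (j,j) \<noteq> 0"
  shows "det (submatrix A (insert j Z) (insert j Z)) =
    A $$ (j,j) * det (submatrix (lu_step n j A) Z Z)"
proof -
  have inZ: "pick Z i < n" "j < pick Z i" "pick Z i \<noteq> j" if "i < card Z" for i
    using pick_in_set_le[OF that] Z by auto
  have "lu_step n j A \<in> carrier_mat n n" by (simp add: lu_step_def)
  moreover have "Z \<subseteq> {..<n}" using Z by auto
  ultimately have eq: "submatrix (lu_step n j A) Z Z =
    mat (card Z) (card Z) (\<lambda>(i,k). lu_step n j A $$ (pick Z i, pick Z k))"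
    by (rule submatrix_principal)
  note s = submatrix_insert_least[OF A j Z]
  show ?thesis
    unfolding det_pivot_factor[OF s(1), unfolded s(2), OF d] eq
    by (intro arg_cong2[where f = "(*)"] refl arg_cong[where f = det] eq_matI)
      (auto simp: s lu_step_def inZ d)
qed

text \<open>
  For \<open>d = A $$ (j,j) - 1\<close>, the minor at \<open>Z\<close> minus the minor at \<open>insert j Z\<close> is the negative of
  the minor at \<open>insert j Z\<close> of the matrix with decremented pivot. This is the algebraic form of
  excluding the event that \<open>j\<close> is sampled.
\<close>

lemma det_submatrix_change_pivot:
  fixes A :: "'a :: comm_ring_1 mat"
  assumes A: "A \<in> carrier_mat n n" and j: "j < n" and Z: "Z \<subseteq> {Suc j..<n}"
  shows "det (submatrix A (insert j Z) (insert j Z)) =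
    det (submatrix (A |\<^sub>m (j,j) \<mapsto> d) (insert j Z) (insert j Z))
    + (A $$ (j,j) - d) * det (submatrix A Z Z)"
proof -
  have inZ: "pick Z i < n" "j < pick Z i" "pick Z i \<noteq> j" if "i < card Z" for i
    using pick_in_set_le[OF that] Z by auto
  have B: "A |\<^sub>m (j,j) \<mapsto> d \<in> carrier_mat n n" using A by auto
  note s = submatrix_insert_least[OF A j Z] and t = submatrix_insert_least[OF B j Z]
  have "Z \<subseteq> {..<n}" using Z by auto
  note eq = submatrix_principal[OF A this]
  have 1: "submatrix A (insert j Z) (insert j Z) |\<^sub>m (0,0) \<mapsto> d =
      submatrix (A |\<^sub>m (j,j) \<mapsto> d) (insert j Z) (insert j Z)" (is "?L = ?R")
  proof (rule eq_matI)
    show "dim_row ?L = dim_row ?R" "dim_col ?L = dim_col ?R" using s(1) t(1) by auto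
    fix i k assume "i < dim_row ?R" "k < dim_col ?R"
    then have "i < Suc (card Z)" "k < Suc (card Z)" using t(1) by auto
    then show "?L $$ (i,k) = ?R $$ (i,k)"
      using carrier_matD[OF s(1)] A j by (auto simp: less_Suc_eq_0_disj s t inZ simp del: pick.simps)
  qed
  have 2: "mat (card Z) (card Z) (\<lambda>(i,k). submatrix A (insert j Z) (insert j Z) $$ (Suc i, Suc k))
      = submatrix A Z Z"
    unfolding eq by (rule eq_matI) (auto simp: s)
  show ?thesis
    using det_change_corner[OF s(1), of d] unfolding 1 2 s(2) .
qed

section \<open>Loops with deterministic bodies\<close>

lemma return_and_then: "return_spmf (x, s) \<triangleright> f = map_spmf (\<lambda>(y, t). (y, s + t)) (f x)"
  by (simp add: and_then_def)

lemma ret_and_then: "ret x \<triangleright> f = f x"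
  by (simp add: ret_def return_and_then map_spmf_conv_bind_spmf split_def)

lemma and_then_ret: "m \<triangleright> ret = m"
  by (simp add: ret_def and_then_def split_def)

lemma and_then_assoc: "m \<triangleright> f \<triangleright> g = m \<triangleright> (\<lambda>x. f x \<triangleright> g)"
  by (simp add: and_then_def map_spmf_conv_bind_spmf split_def add.assoc)

lemma for_each_append: "for_each (xs @ ys) f s = for_each xs f s \<triangleright> for_each ys f"
proof (induction xs arbitrary: s)
  case Nil
  show ?case by (simp add: ret_and_then)
next
  case (Cons x xs)
  have "for_each (xs @ ys) f = (\<lambda>s. for_each xs f s \<triangleright> for_each ys f)"
    using Cons.IH by (rule ext)
  then show ?case by (simp add: and_then_assoc)
qed

lemma for_each_snoc: "for_each (xs @ [x]) f s = for_each xs f s \<triangleright> f x"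
proof -
  have "for_each [] f = ret" by (rule ext) simp
  then have "for_each [x] f s = f x s" for s by (simp add: and_then_ret)
  then have "for_each [x] f = f x" by (rule ext)
  then show ?thesis by (simp add: for_each_append)
qed

text \<open>
  A loop whose body is deterministic along the sequence of states \<open>F a, F (a + 1), \<dots>\<close> runs through
  that sequence; the induction is on the last iteration.
\<close>

lemma for_each_deterministic:
  assumes "a \<le> b"
    and "\<And>k. a \<le> k \<Longrightarrow> k < b \<Longrightarrow> f k (F k) = return_spmf (F (Suc k), w k)"
  shows "for_each [a..<b] f (F a) = return_spmf (F b, \<Sum>k=a..<b. w k)"
  using assms
proof (induction b rule: dec_induct)
  case base
  then show ?case by (simp add: ret_def)
next
  case (step m)
  then show ?case
    by (simp add: for_each_snoc return_and_then)
qed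

lemma scale_entry_eq:
  assumes "A $$ (j,j) \<noteq> 0"
  shows "scale_entry j i A = return_spmf (A |\<^sub>m (i,j) \<mapsto> A $$ (i,j) / A $$ (j,j), 1)"
  using assms by (simp add: scale_entry_def fl_div_def flop_def return_and_then ret_def)

lemma schur_entry_eq:
  "schur_entry j i k A = return_spmf (A |\<^sub>m (i,k) \<mapsto> A $$ (i,k) - A $$ (i,j) * A $$ (j,k), 2)"
  by (simp add: schur_entry_def fl_mult_def fl_sub_def flop_def return_and_then ret_def)

lemma reflect_entry_eq:
  "reflect_entry j k A = return_spmf (A |\<^sub>m (j,k) \<mapsto> cnj (A $$ (k,j)), 1)"
  by (simp add: reflect_entry_def fl_cnj_def flop_def return_and_then ret_def)

lemma scale_loop:
  assumes A: "A \<in> carrier_mat n n" and j: "j < n" and d: "A $$ (j,j) \<noteq> 0"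
  shows "for_each [j+1..<n] (scale_entry j) A =
    return_spmf (mat n n (\<lambda>(i,k). if j < i \<and> k = j then A $$ (i,j) / A $$ (j,j) else A $$ (i,k)),
      n - Suc j)"
proof -
  define F where "F m = mat n n (\<lambda>(i,k).
    if j < i \<and> i < m \<and> k = j then A $$ (i,j) / A $$ (j,j) else A $$ (i,k))" for m
  have "scale_entry j m (F m) = return_spmf (F (Suc m), 1)" if "j + 1 \<le> m" "m < n" for m
  proof -
    have "F m $$ (j,j) = A $$ (j,j)" "F m $$ (m,j) = A $$ (m,j)"
      using j that by (auto simp: F_def)
    moreover have "F m |\<^sub>m (m,j) \<mapsto> A $$ (m,j) / A $$ (j,j) = F (Suc m)"
      using that by (intro eq_matI) (auto simp: F_def update_mat_def less_Suc_eq)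
    ultimately show ?thesis using d by (simp add: scale_entry_eq)
  qed
  from for_each_deterministic[of "j + 1" n "scale_entry j" F "\<lambda>_. 1", OF _ this]
  have "for_each [j+1..<n] (scale_entry j) (F (j+1)) = return_spmf (F n, n - Suc j)"
    using j by simp
  moreover have "F (j+1) = A" using A by (intro eq_matI) (auto simp: F_def)
  moreover have "F n = mat n n (\<lambda>(i,k). if j < i \<and> k = j then A $$ (i,j) / A $$ (j,j) else A $$ (i,k))"
    unfolding F_def by (rule eq_matI) auto
  ultimately show ?thesis by simp
qed

text \<open>
  The update loop over a region whose row \<open>i\<close> extends up to column \<open>h i\<close>, which covers both the full
  trailing block (\<open>h i = n\<close>) and its lower triangle (\<open>h i = i + 1\<close>). Row \<open>j\<close> and column \<open>j\<close> are never
  written, so every update reads their initial values.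
\<close>

lemma schur_loop:
  assumes A: "A \<in> carrier_mat n n" and j: "j < n"
    and h: "\<And>i. j < i \<Longrightarrow> i < n \<Longrightarrow> j < h i \<and> h i \<le> n"
  shows "for_each [j+1..<n] (\<lambda>i. for_each [j+1..<h i] (schur_entry j i)) A =
    return_spmf (mat n n (\<lambda>(i,k). if j < i \<and> j < k \<and> k < h i
        then A $$ (i,k) - A $$ (i,j) * A $$ (j,k) else A $$ (i,k)),
      \<Sum>i=j+1..<n. 2 * (h i - Suc j))"
proof -
  \<comment> \<open>\<open>G r m\<close>: rows before \<open>r\<close> are done, and in row \<open>r\<close> the columns before \<open>m\<close>.\<close>
  define G where "G r m = mat n n (\<lambda>(i,k).
    if j < i \<and> j < k \<and> k < h i \<and> (i < r \<or> i = r \<and> k < m)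
    then A $$ (i,k) - A $$ (i,j) * A $$ (j,k) else A $$ (i,k))" for r m
  have row: "for_each [j+1..<h r] (schur_entry j r) (G r 0) =
      return_spmf (G (Suc r) 0, 2 * (h r - Suc j))" if r: "j + 1 \<le> r" "r < n" for r
  proof -
    have "schur_entry j r m (G r m) = return_spmf (G r (Suc m), 2)" if "j + 1 \<le> m" "m < h r" for m
    proof -
      have m: "m < n" "j < n" using that h[of r] r by auto
      have "G r m $$ (r,m) = A $$ (r,m)" "G r m $$ (r,j) = A $$ (r,j)" "G r m $$ (j,m) = A $$ (j,m)"
        using m r that by (auto simp: G_def)
      moreover have "G r m |\<^sub>m (r,m) \<mapsto> A $$ (r,m) - A $$ (r,j) * A $$ (j,m) = G r (Suc m)"
        using that r m by (intro eq_matI) (auto simp: G_def update_mat_def less_Suc_eq)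
      ultimately show ?thesis by (simp add: schur_entry_eq)
    qed
    from for_each_deterministic[of "j + 1" "h r" "schur_entry j r" "G r" "\<lambda>_. 2", OF _ this]
    have "for_each [j+1..<h r] (schur_entry j r) (G r (j+1)) = return_spmf (G r (h r), 2 * (h r - Suc j))"
      using h[of r] r by simp
    moreover have "G r (j+1) = G r 0" "G r (h r) = G (Suc r) 0"
      by (intro eq_matI; auto simp: G_def less_Suc_eq)+
    ultimately show ?thesis by simp
  qed
  from for_each_deterministic[of "j + 1" n "\<lambda>i. for_each [j+1..<h i] (schur_entry j i)"
      "\<lambda>r. G r 0" "\<lambda>r. 2 * (h r - Suc j)", OF _ row]
  have "for_each [j+1..<n] (\<lambda>i. for_each [j+1..<h i] (schur_entry j i)) (G (j+1) 0) =
      return_spmf (G n 0, \<Sum>i=j+1..<n. 2 * (h i - Suc j))"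
    using j by simp
  moreover have "G (j+1) 0 = A" using A by (intro eq_matI) (auto simp: G_def)
  moreover have "G n 0 = mat n n (\<lambda>(i,k). if j < i \<and> j < k \<and> k < h i
        then A $$ (i,k) - A $$ (i,j) * A $$ (j,k) else A $$ (i,k))"
    unfolding G_def by (rule eq_matI) auto
  ultimately show ?thesis by simp
qed

lemma reflect_loop:
  assumes A: "A \<in> carrier_mat n n" and j: "j < n"
  shows "for_each [j+1..<n] (reflect_entry j) A =
    return_spmf (mat n n (\<lambda>(i,k). if i = j \<and> j < k then cnj (A $$ (k,j)) else A $$ (i,k)),
      n - Suc j)"
proof -
  define F where "F m = mat n n (\<lambda>(i,k).
    if i = j \<and> j < k \<and> k < m then cnj (A $$ (k,j)) else A $$ (i,k))" for m
  have "reflect_entry j m (F m) = return_spmf (F (Suc m), 1)" if "j + 1 \<le> m" "m < n" for m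
  proof -
    have "F m $$ (m,j) = A $$ (m,j)"
      using j that by (auto simp: F_def)
    moreover have "F m |\<^sub>m (j,m) \<mapsto> cnj (A $$ (m,j)) = F (Suc m)"
      using that by (intro eq_matI) (auto simp: F_def update_mat_def less_Suc_eq)
    ultimately show ?thesis by (simp add: reflect_entry_eq)
  qed
  from for_each_deterministic[of "j + 1" n "reflect_entry j" F "\<lambda>_. 1", OF _ this]
  have "for_each [j+1..<n] (reflect_entry j) (F (j+1)) = return_spmf (F n, n - Suc j)"
    using j by simp
  moreover have "F (j+1) = A" using A by (intro eq_matI) (auto simp: F_def)
  moreover have "F n = mat n n (\<lambda>(i,k). if i = j \<and> j < k then cnj (A $$ (k,j)) else A $$ (i,k))"
    unfolding F_def by (rule eq_matI) auto
  ultimately show ?thesis by simp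
qed

lemma lu_step_carrier [simp]: "lu_step n j A \<in> carrier_mat n n"
  by (simp add: lu_step_def)

lemma lu_eliminate_eq:
  assumes A: "A \<in> carrier_mat n n" and j: "j < n" and d: "A $$ (j,j) \<noteq> 0"
  shows "lu_eliminate n j A =
    return_spmf (lu_step n j A, (n - Suc j) + 2 * (n - Suc j) * (n - Suc j))"
proof -
  let ?B = "mat n n (\<lambda>(i,k). if j < i \<and> k = j then A $$ (i,j) / A $$ (j,j) else A $$ (i,k))"
  have "for_each [j+1..<n] (\<lambda>i. for_each [j+1..<n] (schur_entry j i)) ?B =
      return_spmf (lu_step n j A, (n - Suc j) * (2 * (n - Suc j)))"
    by (subst schur_loop[where h = "\<lambda>_. n"])
      (use j in \<open>auto simp: lu_step_def intro!: eq_matI\<close>)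
  then show ?thesis
    unfolding lu_eliminate_def scale_loop[OF A j d] return_and_then by (simp add: algebra_simps)
qed

text \<open>
  The elimination of the Hermitian variant in closed form. The entries above the diagonal in the
  trailing block keep stale values; row \<open>j\<close> is restored from column \<open>j\<close> before it is used.
\<close>

definition ldl_step :: "nat \<Rightarrow> nat \<Rightarrow> complex mat \<Rightarrow> complex mat" where
  "ldl_step n j A = mat n n (\<lambda>(i,k).
     if i = j \<and> j < k then cnj (A $$ (k,j))
     else if j < i \<and> k = j then A $$ (i,j) / A $$ (j,j)
     else if j < k \<and> k \<le> i then A $$ (i,k) - A $$ (i,j) / A $$ (j,j) * cnj (A $$ (k,j))
     else A $$ (i,k))"

lemma ldl_step_carrier [simp]: "ldl_step n j A \<in> carrier_mat n n"
  by (simp add: ldl_step_def)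

lemma sum_twice_upto:
  assumes "j < n"
  shows "(\<Sum>i=j+1..<n. 2 * (i + 1 - Suc j)) = (n - Suc j) * (n - Suc j) + (n - Suc j)"
proof -
  have "(\<Sum>i=j+1..<j+1+d. 2 * (i + 1 - Suc j)) = d * d + d" for d
    by (induction d) auto
  from this[of "n - Suc j"] assms show ?thesis by simp
qed

lemma ldl_eliminate_eq:
  assumes A: "A \<in> carrier_mat n n" and j: "j < n" and d: "A $$ (j,j) \<noteq> 0"
  shows "ldl_eliminate n j A =
    return_spmf (ldl_step n j A, 3 * (n - Suc j) + (n - Suc j) * (n - Suc j))"
proof -
  let ?B = "mat n n (\<lambda>(i,k). if i = j \<and> j < k then cnj (A $$ (k,j)) else A $$ (i,k))"
  let ?C = "mat n n (\<lambda>(i,k). if j < i \<and> k = j then ?B $$ (i,j) / ?B $$ (j,j) else ?B $$ (i,k))"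
  have "?B $$ (j,j) \<noteq> 0" using d j by simp
  note scale = scale_loop[OF mat_carrier j this]
  have "for_each [j+1..<n] (\<lambda>i. for_each [j+1..<i+1] (schur_entry j i)) ?C =
      return_spmf (ldl_step n j A, (n - Suc j) * (n - Suc j) + (n - Suc j))"
    unfolding sum_twice_upto[OF j, symmetric]
    by (subst schur_loop[where h = "\<lambda>i. i + 1"])
      (use j in \<open>auto simp: ldl_step_def intro!: eq_matI\<close>)
  then show ?thesis
    unfolding ldl_eliminate_def reflect_loop[OF A j] return_and_then scale
    by (simp add: return_and_then)
qed

section \<open>Trajectories and the law of the sampler\<close>

text \<open>
  If \<open>p x\<close> is the conditional probability of \<open>B\<close> given the value of \<open>f\<close> at \<open>x\<close>, then replacing the bit
  \<open>x \<in> B\<close> by a fresh Bernoulli bit with parameter \<open>p x\<close> does not change the joint law with \<open>f x\<close>.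
\<close>

lemma bind_bernoulli_conditional:
  assumes cond: "\<And>x. x \<in> set_pmf P \<Longrightarrow>
      p x * measure_pmf.prob P {y. f y = f x} = measure_pmf.prob P {y. f y = f x \<and> y \<in> B}"
  shows "bind_pmf P (\<lambda>x. map_pmf (Pair (f x)) (bernoulli_pmf (p x))) = map_pmf (\<lambda>x. (f x, x \<in> B)) P"
proof (rule pmf_eqI, safe)
  fix t b
  let ?F = "{y. f y = t}"
  have pt: "pmf (map_pmf (Pair (f x)) (bernoulli_pmf (p x))) (t, b) =
      (if f x = t then pmf (bernoulli_pmf (p x)) b else 0)" for x
    by (simp add: pmf_map vimage_def measure_pmf_single)
  show "pmf (bind_pmf P (\<lambda>x. map_pmf (Pair (f x)) (bernoulli_pmf (p x)))) (t, b) =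
      pmf (map_pmf (\<lambda>x. (f x, x \<in> B)) P) (t, b)"
  proof (cases "\<exists>x\<in>set_pmf P. f x = t")
    case False
    have "(t, b) \<notin> set_pmf (bind_pmf P (\<lambda>x. map_pmf (Pair (f x)) (bernoulli_pmf (p x))))"
      and "(t, b) \<notin> set_pmf (map_pmf (\<lambda>x. (f x, x \<in> B)) P)"
      using False by auto
    then show ?thesis unfolding pmf_eq_0_set_pmf[symmetric] by (simp only:)
  next
    case True
    then obtain x where x: "x \<in> set_pmf P" "f x = t" by blast
    let ?m = "measure_pmf.prob P ?F" and ?mB = "measure_pmf.prob P {y. f y = t \<and> y \<in> B}"
    have pos: "?m > 0"
      using x by (intro measure_pmf_posI[of x]) auto
    have p: "p y = ?mB / ?m" if "y \<in> set_pmf P" "f y = t" for y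
      using cond[OF that(1)] that(2) pos by (simp add: field_simps)
    have le: "?mB \<le> ?m" by (intro measure_pmf.finite_measure_mono) auto
    have rng: "0 \<le> p x" "p x \<le> 1" using pos le by (simp_all add: p[OF x])
    have "pmf (bind_pmf P (\<lambda>x. map_pmf (Pair (f x)) (bernoulli_pmf (p x)))) (t, b) =
        (\<integral>y. indicator ?F y * pmf (bernoulli_pmf (p x)) b \<partial>measure_pmf P)"
      unfolding pmf_bind pt
      by (intro integral_cong_AE) (auto simp: AE_measure_pmf_iff p x)
    also have "\<dots> = ?m * pmf (bernoulli_pmf (p x)) b" by simp
    also have "\<dots> = measure_pmf.prob P {y. f y = t \<and> (y \<in> B) = b}"
    proof (cases b)
      case True
      then show ?thesis using rng pos by (simp add: p[OF x])
    next
      case False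
      have "{y. f y = t \<and> y \<notin> B} = ?F - {y. f y = t \<and> y \<in> B}" by auto
      then have "measure_pmf.prob P {y. f y = t \<and> y \<notin> B} = ?m - ?mB"
        by (simp add: measure_pmf.finite_measure_Diff subset_eq)
      then show ?thesis using False rng pos by (simp add: p[OF x] right_diff_distrib)
    qed
    also have "\<dots> = pmf (map_pmf (\<lambda>x. (f x, x \<in> B)) P) (t, b)"
      by (simp add: pmf_map vimage_def)
    finally show ?thesis .
  qed
qed

text \<open>
  The matrix after the draw of step \<open>j\<close>, if the outcome of the draws is \<open>S\<close>: the diagonal entry is
  decremented exactly when \<open>j\<close> is rejected.
\<close>

definition pivot :: "nat set \<Rightarrow> nat \<Rightarrow> complex mat \<Rightarrow> complex mat" where
  "pivot S j A = (if j \<in> S then A else A |\<^sub>m (j,j) \<mapsto> A $$ (j,j) - 1)"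

text \<open>
  The matrix after \<open>j\<close> steps of the sampler on input \<open>K\<close> if the draws come out as prescribed by \<open>S\<close>,
  where \<open>E i\<close> is the elimination carried out in step \<open>i\<close>. Only \<open>S \<inter> {..<j}\<close> matters.
\<close>

primrec trajectory ::
  "(nat \<Rightarrow> complex mat \<Rightarrow> complex mat) \<Rightarrow> complex mat \<Rightarrow> nat set \<Rightarrow> nat \<Rightarrow> complex mat" where
  "trajectory E K S 0 = K"
| "trajectory E K S (Suc j) = E j (pivot S j (trajectory E K S j))"

text \<open>
  The number of operations of the first \<open>j\<close> steps, if the elimination in step \<open>i\<close> takes \<open>w i\<close>
  operations: a rejection adds the subtraction that decrements the pivot.
\<close>

definition trajectory_cost :: "(nat \<Rightarrow> nat) \<Rightarrow> nat set \<Rightarrow> nat \<Rightarrow> nat" where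
  "trajectory_cost w S j = (\<Sum>i<j. of_bool (i \<notin> S) + w i)"

lemma pivot_carrier [simp]: "A \<in> carrier_mat n n \<Longrightarrow> pivot S j A \<in> carrier_mat n n"
  by (auto simp: pivot_def)

lemma trajectory_cong:
  "S \<inter> {..<j} = S' \<inter> {..<j} \<Longrightarrow> trajectory E K S j = trajectory E K S' j"
proof (induction j)
  case (Suc j)
  have "i \<in> S \<longleftrightarrow> i \<in> S'" if "i < Suc j" for i
    using Suc.prems that by (metis IntI Int_iff lessThan_iff)
  then have "S \<inter> {..<j} = S' \<inter> {..<j}" "j \<in> S \<longleftrightarrow> j \<in> S'" by auto
  with Suc.IH show ?case by (simp add: pivot_def)
qed simp

lemma trajectory_cost_cong:
  "S \<inter> {..<j} = S' \<inter> {..<j} \<Longrightarrow> trajectory_cost w S j = trajectory_cost w S' j"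
  unfolding trajectory_cost_def by (intro sum.cong) (auto simp: set_eq_iff)

lemma trajectory_carrier:
  assumes "K \<in> carrier_mat n n" "\<And>j A. A \<in> carrier_mat n n \<Longrightarrow> E j A \<in> carrier_mat n n"
  shows "trajectory E K S j \<in> carrier_mat n n"
  by (induction j) (simp_all add: assms)

lemma draw_and_then:
  assumes "0 \<le> p" "p \<le> 1"
  shows "draw (complex_of_real p) \<triangleright> f = bind_pmf (bernoulli_pmf p) f"
  using assms by (simp add: draw_def and_then_def bind_map_pmf)

text \<open>
  No step gets stuck: after an acceptance \<open>p \<noteq> 0\<close>, after a rejection \<open>p \<noteq> 1\<close>, so the pivot
  \<open>p\<close> or \<open>p - 1\<close> is almost surely nonzero.
\<close>

lemma dpp_step_eq:
  fixes p :: real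
  assumes A: "A \<in> carrier_mat n n" and j: "j < n" and Y: "j \<notin> Y"
    and p: "A $$ (j,j) = complex_of_real p" "0 \<le> p" "p \<le> 1"
    and elim: "\<And>B. B \<in> carrier_mat n n \<Longrightarrow> B $$ (j,j) \<noteq> 0 \<Longrightarrow> eliminate j B = return_spmf (E j B, w j)"
  shows "dpp_step eliminate j (Y, A) = spmf_of_pmf (map_pmf (\<lambda>b.
      let S = if b then insert j Y else Y in ((S, E j (pivot S j A)), of_bool (\<not> b) + w j))
      (bernoulli_pmf p))" (is "_ = spmf_of_pmf (map_pmf ?g _)")
proof -
  let ?f = "\<lambda>b. if b then eliminate j A \<triangleright> (\<lambda>A'. ret (insert j Y, A'))
       else fl_sub (complex_of_real p) 1 \<triangleright> (\<lambda>d.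
            eliminate j (A |\<^sub>m (j, j) \<mapsto> d) \<triangleright> (\<lambda>A'. ret (Y, A')))"
  have "dpp_step eliminate j (Y, A) = bind_pmf (bernoulli_pmf p) ?f"
    unfolding dpp_step_def prod.case p(1) by (rule draw_and_then[OF p(2,3)])
  also have "\<dots> = bind_pmf (bernoulli_pmf p) (\<lambda>b. return_spmf (?g b))"
  proof (intro bind_pmf_cong refl)
    fix b assume b: "b \<in> set_pmf (bernoulli_pmf p)"
    show "?f b = return_spmf (?g b)"
    proof (cases b)
      case True
      then have "p \<noteq> 0" using b p by (auto simp: set_pmf_iff)
      with True show ?thesis using A p
        by (simp add: elim return_and_then ret_def pivot_def)
    next
      case False
      then have "p \<noteq> 1" using b p by (auto simp: set_pmf_iff)
      then have "complex_of_real p - 1 \<noteq> 0" by (metis eq_iff_diff_eq_0 of_real_eq_1_iff)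
      then have "eliminate j (A |\<^sub>m (j,j) \<mapsto> complex_of_real p - 1) =
          return_spmf (E j (A |\<^sub>m (j,j) \<mapsto> complex_of_real p - 1), w j)"
        using A j by (intro elim) auto
      with False show ?thesis using p Y
        by (simp add: return_and_then ret_def pivot_def fl_sub_def flop_def)
    qed
  qed
  also have "\<dots> = spmf_of_pmf (map_pmf ?g (bernoulli_pmf p))"
    by (rule bind_pmf_return_spmf)
  finally show ?thesis .
qed

text \<open>
  If along every trajectory in the support the diagonal entry met in step \<open>j\<close> is the conditional
  probability that \<open>j\<close> belongs to the random set, given its part below \<open>j\<close>, then running the sampler
  amounts to drawing \<open>S\<close> from \<open>P\<close> and following the trajectory of \<open>S\<close>. The statement leaves the
  elimination open because both variants are instances.
\<close>

lemma sampler_law: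
  assumes K: "K \<in> carrier_mat n n" and supp: "set_pmf P \<subseteq> Pow {..<n}"
    and carrier: "\<And>j A. A \<in> carrier_mat n n \<Longrightarrow> E j A \<in> carrier_mat n n"
    and elim: "\<And>j A. j < n \<Longrightarrow> A \<in> carrier_mat n n \<Longrightarrow> A $$ (j,j) \<noteq> 0 \<Longrightarrow>
      eliminate j A = return_spmf (E j A, w j)"
    and cond: "\<And>S j. S \<in> set_pmf P \<Longrightarrow> j < n \<Longrightarrow>
      trajectory E K S j $$ (j,j) * complex_of_real (measure_pmf.prob P {S'. S' \<inter> {..<j} = S \<inter> {..<j}})
      = complex_of_real (measure_pmf.prob P {S'. S' \<inter> {..<j} = S \<inter> {..<j} \<and> j \<in> S'})"
  shows "for_each [0..<n] (dpp_step eliminate) ({}, K) =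
    spmf_of_pmf (map_pmf (\<lambda>S. ((S, trajectory E K S n), trajectory_cost w S n)) P)"
proof -
  define R where "R m S = ((S \<inter> {..<m}, trajectory E K S m), trajectory_cost w S m)" for m S
  have "for_each [0..<m] (dpp_step eliminate) ({}, K) = spmf_of_pmf (map_pmf (R m) P)" if "m \<le> n" for m
    using that
  proof (induction m)
    case 0
    have "R 0 = (\<lambda>_. (({}, K), 0))" by (auto simp: R_def trajectory_cost_def)
    then show ?case by (simp add: ret_def spmf_of_pmf_def)
  next
    case (Suc m)
    then have m: "m < n" by simp
    \<comment> \<open>\<open>f\<close>: the past; \<open>upd\<close>: appending the outcome of the draw for \<open>m\<close> to a past.\<close>
    define f where "f S = S \<inter> {..<m}" for S :: "nat set"
    define p where "p S = Re (trajectory E K S m $$ (m,m))" for S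
    define upd where "upd = (\<lambda>(Y, b). if b then insert m Y else Y)"
    have upd: "upd (Y, b) = (if b then insert m Y else Y)" for Y b by (simp add: upd_def)
    have p: "trajectory E K S m $$ (m,m) = complex_of_real (p S)" "0 \<le> p S" "p S \<le> 1"
      "p S * measure_pmf.prob P {S'. f S' = f S} = measure_pmf.prob P {S'. f S' = f S \<and> S' \<in> {S. m \<in> S}}"
      if S: "S \<in> set_pmf P" for S
    proof -
      let ?c = "measure_pmf.prob P {S'. f S' = f S}"
      let ?q = "measure_pmf.prob P {S'. f S' = f S \<and> m \<in> S'}"
      have pos: "?c > 0" using S by (intro measure_pmf_posI[of S]) auto
      have le: "?q \<le> ?c" by (intro measure_pmf.finite_measure_mono) auto
      have eq: "trajectory E K S m $$ (m,m) = complex_of_real (?q / ?c)"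
        using cond[OF S m] pos by (simp add: f_def field_simps)
      then have pS: "p S = ?q / ?c" by (simp add: p_def)
      with eq show "trajectory E K S m $$ (m,m) = complex_of_real (p S)" by simp
      show "0 \<le> p S" "p S \<le> 1" using pos le by (simp_all add: pS)
      show "p S * ?c = measure_pmf.prob P {S'. f S' = f S \<and> S' \<in> {S. m \<in> S}}"
        using pos by (simp add: pS)
    qed
    have R_f: "R (Suc m) (upd (f S, m \<in> S)) = R (Suc m) S" for S
    proof -
      have "upd (f S, m \<in> S) \<inter> {..<Suc m} = S \<inter> {..<Suc m}"
        by (auto simp: upd f_def less_Suc_eq)
      then show ?thesis
        unfolding R_def by (metis trajectory_cong trajectory_cost_cong)
    qed
    have step: "(case R m S of (x, s) \<Rightarrow> map_spmf (\<lambda>(y, t). (y, s + t)) (dpp_step eliminate m x)) =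
        spmf_of_pmf (map_pmf (\<lambda>b. R (Suc m) (upd (f S, b))) (bernoulli_pmf (p S)))"
      if S: "S \<in> set_pmf P" for S
    proof -
      have tr: "trajectory E K (upd (f S, b)) m = trajectory E K S m"
        "trajectory_cost w (upd (f S, b)) m = trajectory_cost w S m" for b
        by (rule trajectory_cong trajectory_cost_cong, auto simp: upd f_def)+
      have R': "R (Suc m) (upd (f S, b)) = ((upd (f S, b), E m (pivot (upd (f S, b)) m (trajectory E K S m))),
          trajectory_cost w S m + (of_bool (\<not> b) + w m))" for b
      proof -
        have "upd (f S, b) \<inter> {..<Suc m} = upd (f S, b)" "m \<in> upd (f S, b) \<longleftrightarrow> b"
          by (auto simp: upd f_def)
        moreover have "trajectory_cost w (upd (f S, b)) (Suc m) =
            trajectory_cost w (upd (f S, b)) m + (of_bool (m \<notin> upd (f S, b)) + w m)"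
          by (simp add: trajectory_cost_def)
        ultimately show ?thesis by (simp add: R_def tr)
      qed
      have "dpp_step eliminate m (f S, trajectory E K S m) = spmf_of_pmf (map_pmf (\<lambda>b.
          let S' = if b then insert m (f S) else f S in
            ((S', E m (pivot S' m (trajectory E K S m))), of_bool (\<not> b) + w m)) (bernoulli_pmf (p S)))"
      proof (rule dpp_step_eq)
        show "trajectory E K S m \<in> carrier_mat n n"
          using K carrier by (rule trajectory_carrier)
        show "m \<notin> f S" by (simp add: f_def)
        show "eliminate m B = return_spmf (E m B, w m)"
          if "B \<in> carrier_mat n n" "B $$ (m,m) \<noteq> 0" for B
          using m that by (rule elim)
      qed (use m p(1-3)[OF S] in auto)
      then show ?thesis
        unfolding R'
        by (simp add: R_def f_def[symmetric] upd map_spmf_of_pmf pmf.map_comp comp_def split_def Let_def)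
    qed
    have "for_each [0..<Suc m] (dpp_step eliminate) ({}, K) =
        spmf_of_pmf (map_pmf (R m) P) \<triangleright> dpp_step eliminate m"
      using Suc by (simp add: for_each_snoc)
    also have "\<dots> = bind_pmf P (\<lambda>S. case R m S of (x, s) \<Rightarrow>
        map_spmf (\<lambda>(y, t). (y, s + t)) (dpp_step eliminate m x))"
      by (simp add: and_then_def bind_spmf_of_pmf bind_map_pmf)
    also have "\<dots> = bind_pmf P (\<lambda>S. spmf_of_pmf (map_pmf (\<lambda>b. R (Suc m) (upd (f S, b))) (bernoulli_pmf (p S))))"
      by (intro bind_pmf_cong refl step)
    also have "\<dots> = spmf_of_pmf (map_pmf (\<lambda>x. R (Suc m) (upd x))
        (bind_pmf P (\<lambda>S. map_pmf (Pair (f S)) (bernoulli_pmf (p S)))))"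
      by (simp add: spmf_of_pmf_def map_bind_pmf pmf.map_comp comp_def)
    also have "\<dots> = spmf_of_pmf (map_pmf (R (Suc m)) P)"
      by (subst bind_bernoulli_conditional[OF p(4)]) (simp_all add: pmf.map_comp comp_def R_f)
    finally show ?case .
  qed
  moreover have "map_pmf (R n) P = map_pmf (\<lambda>S. ((S, trajectory E K S n), trajectory_cost w S n)) P"
    using supp by (intro map_pmf_cong) (auto simp: R_def)
  ultimately show ?thesis by simp
qed

section \<open>Minors along a trajectory\<close>

text \<open>
  The invariant of the sampler. Along the trajectory of a sample \<open>S\<close>, the principal minors of the
  trailing block, scaled by the product of the absolute values of the pivots so far, give the
  probabilities that the random set agrees with \<open>S\<close> below \<open>j\<close> and contains \<open>Z\<close>.
\<close>

lemma trajectory_minors: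
  assumes dpp: "is_DPP K P" and K: "K \<in> carrier_mat n n"
    and S: "S \<in> set_pmf P" and j: "j \<le> n" and Z: "Z \<subseteq> {j..<n}"
  shows "complex_of_real (measure_pmf.prob P {S'. S' \<inter> {..<j} = S \<inter> {..<j} \<and> Z \<subseteq> S'}) =
    complex_of_real (\<Prod>i<j. cmod (trajectory (lu_step n) K S j $$ (i,i)))
      * det (submatrix (trajectory (lu_step n) K S j) Z Z)"
  using j Z
proof (induction j arbitrary: Z)
  case 0
  then have "Z \<subseteq> {..<dim_row K}" using K by auto
  with dpp show ?case by (simp add: is_DPP_def)
next
  case (Suc j)
  let ?P = "measure_pmf.prob P"
  let ?q = "\<lambda>Z. ?P {S'. S' \<inter> {..<j} = S \<inter> {..<j} \<and> Z \<subseteq> S'}"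
  define T where "T = trajectory (lu_step n) K S j"
  define B where "B = pivot S j T"
  define c where "c = (\<Prod>i<j. cmod (T $$ (i,i)))"
  have j: "j < n" using Suc.prems by simp
  have T: "T \<in> carrier_mat n n" unfolding T_def using K by (rule trajectory_carrier) simp
  have B: "B \<in> carrier_mat n n" using T by (simp add: B_def)
  have IH: "complex_of_real (?q Y) = complex_of_real c * det (submatrix T Y Y)" if "Y \<subseteq> {j..<n}" for Y
    using Suc.IH[of Y] that j by (simp add: T_def c_def)
  have q0: "?q {} = c"
  proof -
    have "submatrix T {} {} \<in> carrier_mat 0 0" using T by (simp add: submatrix_def)
    with IH[of "{}"] show ?thesis by simp
  qed
  have "c > 0" unfolding q0[symmetric] using S by (intro measure_pmf_posI[of S]) auto
  \<comment> \<open>The conditional probability that \<open>j\<close> is sampled, given the past recorded in \<open>S\<close>.\<close>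
  define p where "p = ?q {j} / c"
  have Tjj: "T $$ (j,j) = complex_of_real p"
  proof -
    note s = submatrix_insert_least[OF T j, of "{}"]
    have "det (submatrix T {j} {j}) = T $$ (j,j)"
      using s(1,2) by (simp add: det_single)
    with IH[of "{j}"] j \<open>c > 0\<close> show ?thesis by (simp add: p_def)
  qed
  have prod: "(\<Prod>i<Suc j. cmod (lu_step n j B $$ (i,i))) = c * cmod (B $$ (j,j))"
  proof -
    have "lu_step n j B $$ (i,i) = T $$ (i,i)" if "i < j" for i
      using that j T by (auto simp: lu_step_def B_def pivot_def)
    moreover have "lu_step n j B $$ (j,j) = B $$ (j,j)" using j by (simp add: lu_step_def)
    ultimately show ?thesis by (simp add: c_def)
  qed
  have Z: "Z \<subseteq> {Suc j..<n}" "insert j Z \<subseteq> {j..<n}" "Z \<subseteq> {j..<n}" using Suc.prems j by auto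
  have "complex_of_real (?P {S'. S' \<inter> {..<Suc j} = S \<inter> {..<Suc j} \<and> Z \<subseteq> S'}) =
      complex_of_real (c * cmod (B $$ (j,j))) * det (submatrix (lu_step n j B) Z Z)"
  proof (cases "j \<in> S")
    case True
    have "?q {j} > 0" using S True by (intro measure_pmf_posI[of S]) auto
    then have "p > 0" using \<open>c > 0\<close> by (simp add: p_def)
    have BT: "B = T" using True by (simp add: B_def pivot_def)
    have "{S'. S' \<inter> {..<Suc j} = S \<inter> {..<Suc j} \<and> Z \<subseteq> S'} =
        {S'. S' \<inter> {..<j} = S \<inter> {..<j} \<and> insert j Z \<subseteq> S'}"
      using True by (auto simp: lessThan_Suc)
    with IH[OF Z(2)] have "complex_of_real (?P {S'. S' \<inter> {..<Suc j} = S \<inter> {..<Suc j} \<and> Z \<subseteq> S'}) =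
        complex_of_real c * det (submatrix T (insert j Z) (insert j Z))" by simp
    also have "\<dots> = complex_of_real c * (complex_of_real p * det (submatrix (lu_step n j T) Z Z))"
      using det_submatrix_lu_step[OF T j Z(1)] \<open>p > 0\<close> by (simp add: Tjj)
    finally show ?thesis using \<open>p > 0\<close> by (simp add: BT Tjj)
  next
    case False
    have Bjj: "B $$ (j,j) = complex_of_real (p - 1)"
      using False T j by (simp add: B_def pivot_def Tjj)
    \<comment> \<open>Agreement up to and including \<open>j\<close> now means: agreement below \<open>j\<close>, but not containing \<open>j\<close>.\<close>
    have diff: "?P {S'. S' \<inter> {..<Suc j} = S \<inter> {..<Suc j} \<and> Y \<subseteq> S'} = ?q Y - ?q (insert j Y)" for Y
    proof -
      have "{S'. S' \<inter> {..<Suc j} = S \<inter> {..<Suc j} \<and> Y \<subseteq> S'} =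
          {S'. S' \<inter> {..<j} = S \<inter> {..<j} \<and> Y \<subseteq> S'} -
          {S'. S' \<inter> {..<j} = S \<inter> {..<j} \<and> insert j Y \<subseteq> S'}"
        using False by (auto simp: lessThan_Suc)
      then show ?thesis by (simp add: measure_pmf.finite_measure_Diff subset_eq)
    qed
    have "0 < ?P {S'. S' \<inter> {..<Suc j} = S \<inter> {..<Suc j} \<and> {} \<subseteq> S'}"
      using S by (intro measure_pmf_posI[of S]) auto
    then have "?q {j} < c" unfolding diff q0 by simp
    then have "p < 1" using \<open>c > 0\<close> by (simp add: p_def)
    have "complex_of_real (?P {S'. S' \<inter> {..<Suc j} = S \<inter> {..<Suc j} \<and> Z \<subseteq> S'}) =
        complex_of_real c * (det (submatrix T Z Z) - det (submatrix T (insert j Z) (insert j Z)))"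
      unfolding diff using IH[OF Z(2)] IH[OF Z(3)] by (simp add: algebra_simps)
    also have "det (submatrix T Z Z) - det (submatrix T (insert j Z) (insert j Z)) =
        - det (submatrix B (insert j Z) (insert j Z))"
      using det_submatrix_change_pivot[OF T j Z(1), of "T $$ (j,j) - 1"] False
      by (simp add: B_def pivot_def)
    also have "\<dots> = complex_of_real (1 - p) * det (submatrix (lu_step n j B) Z Z)"
    proof -
      have "B $$ (j,j) \<noteq> 0" using \<open>p < 1\<close> unfolding Bjj of_real_eq_0_iff by simp
      from det_submatrix_lu_step[OF B j Z(1) this] show ?thesis
        unfolding Bjj by (simp add: algebra_simps)
    qed
    also have "1 - p = cmod (B $$ (j,j))"
      unfolding Bjj norm_of_real using \<open>p < 1\<close> by simp
    finally show ?thesis by simp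
  qed
  then show ?case
    unfolding trajectory.simps T_def[symmetric] B_def[symmetric] prod .
qed

lemma trajectory_agreement_prob:
  assumes "is_DPP K P" "K \<in> carrier_mat n n" "S \<in> set_pmf P" "j \<le> n"
  shows "measure_pmf.prob P {S'. S' \<inter> {..<j} = S \<inter> {..<j}} =
    (\<Prod>i<j. cmod (trajectory (lu_step n) K S j $$ (i,i)))"
proof -
  have "submatrix (trajectory (lu_step n) K S j) {} {} \<in> carrier_mat 0 0"
    by (simp add: submatrix_def)
  with trajectory_minors[OF assms, of "{}"] show ?thesis
    by (simp del: of_real_prod)
qed

lemma trajectory_pivot:
  assumes dpp: "is_DPP K P" "K \<in> carrier_mat n n" "S \<in> set_pmf P" and j: "j < n"
  shows "trajectory (lu_step n) K S j $$ (j,j)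
      * complex_of_real (measure_pmf.prob P {S'. S' \<inter> {..<j} = S \<inter> {..<j}}) =
    complex_of_real (measure_pmf.prob P {S'. S' \<inter> {..<j} = S \<inter> {..<j} \<and> j \<in> S'})"
proof -
  let ?T = "trajectory (lu_step n) K S j"
  have T: "?T \<in> carrier_mat n n" using dpp(2) by (rule trajectory_carrier) simp
  have "det (submatrix ?T {j} {j}) = ?T $$ (j,j)"
    using submatrix_insert_least(1,2)[OF T j, of "{}"] by (simp add: det_single)
  with trajectory_minors[OF dpp, of j "{j}"] trajectory_agreement_prob[OF dpp, of j] j
  show ?thesis by simp
qed

lemma likelihood_eq_prod_diag:
  assumes dpp: "is_DPP K P" "K \<in> carrier_mat n n" "S \<in> set_pmf P"
  shows "pmf P S = (\<Prod>j<n. cmod (trajectory (lu_step n) K S n $$ (j,j)))"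
proof -
  have supp: "set_pmf P \<subseteq> Pow {..<n}" using dpp(1,2) by (auto simp: is_DPP_def)
  have "{S'. S' \<inter> {..<n} = S \<inter> {..<n}} \<inter> set_pmf P = {S} \<inter> set_pmf P"
    using supp dpp(3) by auto
  then have "measure_pmf.prob P {S'. S' \<inter> {..<n} = S \<inter> {..<n}} = measure_pmf.prob P {S}"
    by (metis measure_Int_set_pmf)
  with trajectory_agreement_prob[OF dpp order_refl] show ?thesis
    by (simp add: measure_pmf_single)
qed

section \<open>The Hermitian variant\<close>

text \<open>
  Elimination keeps the trailing block Hermitian; decrementing a real diagonal entry does as well.
\<close>

lemma trajectory_hermitian:
  assumes K: "K \<in> carrier_mat n n" and herm: "hermitian_mat K"
    and "j \<le> i" "i < n" "j \<le> k" "k < n"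
  shows "trajectory (lu_step n) K S j $$ (k,i) = cnj (trajectory (lu_step n) K S j $$ (i,k))"
  using assms(3-)
proof (induction j arbitrary: i k)
  case 0
  have "K $$ (k,i) = mat_adjoint K $$ (k,i)" using herm by (simp add: hermitian_mat_def)
  also have "\<dots> = cnj (K $$ (i,k))"
    using K 0 by (simp add: mat_adjoint_def mat_of_rows_def)
  finally show ?case by simp
next
  case (Suc j)
  define T where "T = trajectory (lu_step n) K S j"
  have T: "T \<in> carrier_mat n n" unfolding T_def using K by (rule trajectory_carrier) simp
  have IH: "T $$ (b,a) = cnj (T $$ (a,b))" if "j \<le> a" "a < n" "j \<le> b" "b < n" for a b
    unfolding T_def using Suc.IH that by blast
  have B: "pivot S j T $$ (b,a) = cnj (pivot S j T $$ (a,b))" if "j \<le> a" "a < n" "j \<le> b" "b < n" for a b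
    using that T IH[OF that] by (cases "a = j \<and> b = j") (auto simp: pivot_def)
  have "lu_step n j (pivot S j T) $$ (k,i) = cnj (lu_step n j (pivot S j T) $$ (i,k))"
    using Suc.prems B[of i k] B[of i j] B[of j k] B[of j j]
    by (auto simp: lu_step_def)
  then show ?case by (simp add: T_def)
qed

text \<open>
  The two trajectories agree on the finished rows and on the lower triangle, diagonal included.
  After \<open>n\<close> steps every row is finished.
\<close>

lemma ldl_trajectory_agrees:
  assumes K: "K \<in> carrier_mat n n" and herm: "hermitian_mat K"
    and "j \<le> n" "i < n" "k < n" "i < j \<or> k \<le> i"
  shows "trajectory (ldl_step n) K S j $$ (i,k) = trajectory (lu_step n) K S j $$ (i,k)"
  using assms(3-)
proof (induction j arbitrary: i k)
  case 0
  then show ?case by simp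
next
  case (Suc j)
  define T where "T = trajectory (lu_step n) K S j"
  define H where "H = trajectory (ldl_step n) K S j"
  define B where "B = pivot S j T"
  define C where "C = pivot S j H"
  have j: "j < n" using Suc.prems by simp
  have TH: "T \<in> carrier_mat n n" "H \<in> carrier_mat n n"
    unfolding T_def H_def using K by (rule trajectory_carrier, simp)+
  have HT: "H $$ (a,b) = T $$ (a,b)" if "a < n" "b < n" "a < j \<or> b \<le> a" for a b
    unfolding T_def H_def using Suc.IH Suc.prems(1) that by simp
  have CB: "C $$ (a,b) = B $$ (a,b)" if "a < n" "b < n" "a < j \<or> b \<le> a" for a b
    using TH HT[OF that] that j
    by (cases "a = j \<and> b = j") (auto simp: B_def C_def pivot_def)
  have row: "cnj (B $$ (b,j)) = B $$ (j,b)" if "j < b" "b < n" for b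
    using trajectory_hermitian[OF K herm, of j j b S] that j TH
    by (simp add: B_def pivot_def T_def)
  have "ldl_step n j C $$ (i,k) = lu_step n j B $$ (i,k)"
    using Suc.prems j CB[of i k] CB[of i j] CB[of j j] CB[of k j] row[of k]
    by (auto simp: ldl_step_def lu_step_def)
  then show ?case by (simp add: B_def C_def T_def H_def)
qed

section \<open>The laws of both samplers\<close>

lemma dpp_sampler_eq:
  assumes K: "K \<in> carrier_mat n n" and dpp: "is_DPP K P"
  shows "dpp_sampler n K = spmf_of_pmf (map_pmf (\<lambda>S. ((S, trajectory (lu_step n) K S n),
    trajectory_cost (\<lambda>j. (n - Suc j) + 2 * (n - Suc j) * (n - Suc j)) S n)) P)"
  unfolding dpp_sampler_def
proof (rule sampler_law[OF K])
  show "set_pmf P \<subseteq> Pow {..<n}" using dpp K by (auto simp: is_DPP_def)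
qed (use trajectory_pivot[OF dpp K] lu_eliminate_eq in auto)

lemma dpp_sampler_hermitian_eq:
  assumes K: "K \<in> carrier_mat n n" and dpp: "is_DPP K P" and herm: "hermitian_mat K"
  shows "dpp_sampler_hermitian n K = spmf_of_pmf (map_pmf (\<lambda>S. ((S, trajectory (lu_step n) K S n),
    trajectory_cost (\<lambda>j. 3 * (n - Suc j) + (n - Suc j) * (n - Suc j)) S n)) P)"
proof -
  have "dpp_sampler_hermitian n K = spmf_of_pmf (map_pmf (\<lambda>S. ((S, trajectory (ldl_step n) K S n),
    trajectory_cost (\<lambda>j. 3 * (n - Suc j) + (n - Suc j) * (n - Suc j)) S n)) P)"
    unfolding dpp_sampler_hermitian_def
  proof (rule sampler_law[OF K])
    show "set_pmf P \<subseteq> Pow {..<n}" using dpp K by (auto simp: is_DPP_def)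
    show "trajectory (ldl_step n) K S j $$ (j,j)
        * complex_of_real (measure_pmf.prob P {S'. S' \<inter> {..<j} = S \<inter> {..<j}}) =
      complex_of_real (measure_pmf.prob P {S'. S' \<inter> {..<j} = S \<inter> {..<j} \<and> j \<in> S'})"
      if "S \<in> set_pmf P" "j < n" for S j
      using trajectory_pivot[OF dpp K that] ldl_trajectory_agrees[OF K herm, of j j j S] that(2)
      by simp
  qed (use ldl_eliminate_eq in auto)
  moreover have "trajectory (ldl_step n) K S n = trajectory (lu_step n) K S n" for S
  proof -
    have "trajectory (ldl_step n) K S n \<in> carrier_mat n n" "trajectory (lu_step n) K S n \<in> carrier_mat n n"
      using K by (rule trajectory_carrier, simp)+
    then show ?thesis
      using ldl_trajectory_agrees[OF K herm order_refl] by (intro eq_matI) auto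
  qed
  ultimately show ?thesis by simp
qed

section \<open>Operation counts\<close>

lemma trajectory_cost_bounds:
  fixes f :: "nat \<Rightarrow> nat"
  shows "(\<Sum>m<n. f m) \<le> trajectory_cost (\<lambda>j. f (n - Suc j)) S n"
    and "trajectory_cost (\<lambda>j. f (n - Suc j)) S n \<le> n + (\<Sum>m<n. f m)"
proof -
  have eq: "trajectory_cost (\<lambda>j. f (n - Suc j)) S n = (\<Sum>i<n. of_bool (i \<notin> S)) + (\<Sum>m<n. f m)"
    by (simp add: trajectory_cost_def sum.distrib sum.nat_diff_reindex)
  have "(\<Sum>i<n. of_bool (i \<notin> S) :: nat) \<le> (\<Sum>i<n. 1)"
    by (rule sum_mono) simp
  then show "(\<Sum>m<n. f m) \<le> trajectory_cost (\<lambda>j. f (n - Suc j)) S n"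
    "trajectory_cost (\<lambda>j. f (n - Suc j)) S n \<le> n + (\<Sum>m<n. f m)"
    unfolding eq by simp_all
qed

text \<open>
  With \<open>m\<close> rows left, an elimination takes \<open>m\<close> divisions and \<open>m\<^sup>2\<close> updates of two operations each.
\<close>

lemma lu_cost:
  "\<bar>real (trajectory_cost (\<lambda>j. (n - Suc j) + 2 * (n - Suc j) * (n - Suc j)) S n) - 2 / 3 * real n ^ 3\<bar>
    \<le> 1 * real n ^ 2"
proof -
  let ?f = "\<lambda>m. m + 2 * m * m :: nat"
  have sum: "real (\<Sum>m<n. ?f m) = 2 / 3 * real n ^ 3 - real n ^ 2 / 2 - real n / 6"
  proof (induction n)
    case (Suc n)
    have "real (\<Sum>m<Suc n. ?f m) = real (\<Sum>m<n. ?f m) + (real n + 2 * real n * real n)" by simp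
    then show ?case
      unfolding Suc.IH by (simp add: field_simps power2_eq_square power3_eq_cube)
  qed simp
  have "real n \<le> real n ^ 2" using self_le_power[of "real n" 2] by (cases n) auto
  moreover have "real (\<Sum>m<n. ?f m) \<le> real (trajectory_cost (\<lambda>j. ?f (n - Suc j)) S n)"
    "real (trajectory_cost (\<lambda>j. ?f (n - Suc j)) S n) \<le> real n + real (\<Sum>m<n. ?f m)"
    using trajectory_cost_bounds[where f = ?f and n = n and S = S] by linarith+
  ultimately show ?thesis unfolding sum abs_le_iff using of_nat_0_le_iff[of n, where ?'a = real] by linarith
qed

text \<open>
  With \<open>m\<close> rows left, the Hermitian variant takes \<open>m\<close> conjugations, \<open>m\<close> divisions and
  \<open>m (m + 1) / 2\<close> updates of two operations each.
\<close>

lemma ldl_cost: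
  "\<bar>real (trajectory_cost (\<lambda>j. 3 * (n - Suc j) + (n - Suc j) * (n - Suc j)) S n)
      - 1 / 2 * (2 / 3 * real n ^ 3)\<bar> \<le> 1 * real n ^ 2"
proof -
  let ?f = "\<lambda>m. 3 * m + m * m :: nat"
  have sum: "real (\<Sum>m<n. ?f m) = real n ^ 3 / 3 + real n ^ 2 - 4 / 3 * real n"
  proof (induction n)
    case (Suc n)
    have "real (\<Sum>m<Suc n. ?f m) = real (\<Sum>m<n. ?f m) + (3 * real n + real n * real n)" by simp
    then show ?case
      unfolding Suc.IH by (simp add: field_simps power2_eq_square power3_eq_cube)
  qed simp
  have "real n \<le> real n ^ 2" using self_le_power[of "real n" 2] by (cases n) auto
  moreover have "real (\<Sum>m<n. ?f m) \<le> real (trajectory_cost (\<lambda>j. ?f (n - Suc j)) S n)"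
    "real (trajectory_cost (\<lambda>j. ?f (n - Suc j)) S n) \<le> real n + real (\<Sum>m<n. ?f m)"
    using trajectory_cost_bounds[where f = ?f and n = n and S = S] by linarith+
  ultimately show ?thesis unfolding sum abs_le_iff using of_nat_0_le_iff[of n, where ?'a = real] by linarith
qed

section \<open>Correctness, cost and likelihood\<close>

theorem theorem2:
  shows
    "(\<forall>n K P. K \<in> carrier_mat n n \<and> is_DPP K P \<longrightarrow>
        lossless_spmf (dpp_sampler n K) \<and>
        map_spmf (\<lambda>((Y, A), t). Y) (dpp_sampler n K) = spmf_of_pmf P)
   \<and> (\<exists>c::real. \<forall>n K P. K \<in> carrier_mat n n \<and> is_DPP K P \<longrightarrow>
        (\<forall>((Y, A), t) \<in> set_spmf (dpp_sampler n K).
           \<bar>real t - 2 / 3 * real n ^ 3\<bar> \<le> c * real n ^ 2))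
   \<and> (\<forall>n K P. K \<in> carrier_mat n n \<and> is_DPP K P \<longrightarrow>
        (\<forall>((Y, A), t) \<in> set_spmf (dpp_sampler n K).
           pmf P Y = (\<Prod>j<n. cmod (A $$ (j, j)))))
   \<and> (\<forall>n K P. K \<in> carrier_mat n n \<and> is_DPP K P \<and> hermitian_mat K \<longrightarrow>
        map_spmf (\<lambda>((Y, A), t). (Y, A)) (dpp_sampler_hermitian n K) =
        map_spmf (\<lambda>((Y, A), t). (Y, A)) (dpp_sampler n K))
   \<and> (\<exists>c::real. \<forall>n K P. K \<in> carrier_mat n n \<and> is_DPP K P \<and> hermitian_mat K \<longrightarrow>
        (\<forall>((Y, A), t) \<in> set_spmf (dpp_sampler_hermitian n K).
           \<bar>real t - 1 / 2 * (2 / 3 * real n ^ 3)\<bar> \<le> c * real n ^ 2))"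
proof (intro conjI allI impI exI[of _ "1::real"]; (elim conjE)?)
  fix n and K :: "complex mat" and P
  assume K: "K \<in> carrier_mat n n" and dpp: "is_DPP K P"
  note eq = dpp_sampler_eq[OF K dpp]
  show "lossless_spmf (dpp_sampler n K)" by (simp add: eq)
  show "map_spmf (\<lambda>((Y, A), t). Y) (dpp_sampler n K) = spmf_of_pmf P"
    by (simp add: eq pmf.map_comp comp_def)
  show "\<forall>((Y, A), t) \<in> set_spmf (dpp_sampler n K).
      \<bar>real t - 2 / 3 * real n ^ 3\<bar> \<le> 1 * real n ^ 2"
    unfolding eq using lu_cost by auto
  show "\<forall>((Y, A), t) \<in> set_spmf (dpp_sampler n K). pmf P Y = (\<Prod>j<n. cmod (A $$ (j, j)))"
    unfolding eq using likelihood_eq_prod_diag[OF dpp K] by auto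
next
  fix n and K :: "complex mat" and P
  assume K: "K \<in> carrier_mat n n" and dpp: "is_DPP K P" and herm: "hermitian_mat K"
  note eq = dpp_sampler_eq[OF K dpp] dpp_sampler_hermitian_eq[OF K dpp herm]
  show "map_spmf (\<lambda>((Y, A), t). (Y, A)) (dpp_sampler_hermitian n K) =
      map_spmf (\<lambda>((Y, A), t). (Y, A)) (dpp_sampler n K)"
    by (simp add: eq pmf.map_comp comp_def)
  show "\<forall>((Y, A), t) \<in> set_spmf (dpp_sampler_hermitian n K).
      \<bar>real t - 1 / 2 * (2 / 3 * real n ^ 3)\<bar> \<le> 1 * real n ^ 2"
    unfolding eq using ldl_cost by auto
qed

end
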